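(* Let $M=I\times_f F$ be a generalized Robertson-Walker spacetime endowed with the metric $g=-dt^2\oplus f^2g_F$, with fiber an $n$-dimensional Riemannian manifold $(F,g_F)$, and let $\phi=\int_c^t f(z)\,dz$ for some constant $c\in I$. If $(M,g,\mu,\phi)$ is a conformal gradient Ricci soliton, then: (1) the generalized Robertson-Walker spacetime $(M,g)$ is Ricci flat if the soliton constant $\lambda$ satisfies the relation $\lambda=\dot f+\frac p2+\frac1n$; and (2) the generalized Robertson-Walker spacetime $(M,g)$ is an Einstein manifold if the warping function $f$ is of the form $f(t)=at+b$, where $a,b$ are constants.
   Context: A generalized Robertson-Walker spacetime is a warped product $M=I\times_f F$ with the Lorentzian metric $g=-dt^2\oplus f^2g_F$ (that is, $g=-\pi^*dt^2+(f\circ\pi)^2\sigma^*g_F$ on $I\times F$, with $\pi,\sigma$ the projections onto $I$ and $F$), where the base $I$ is an open interval of $\mathbb{R}$ with its usual metric reversed, the fiber $(F,g_F)$ is an $n$-dimensional Riemannian manifold, and $f>0$ is a positive smooth function on $I$. Here $t$ is the coordinate on $I$, $\dot f=df/dt$, and $\phi$ is regarded as a function on $M$ via $\pi$. Conformal gradient Ricci soliton: $(M,g,\mu,\phi)$ is a conformal gradient Ricci soliton if $\mathcal{L}_{\mathrm{grad}\,\phi}g+2\,Ric=\mu g$ (equivalently $2H^\phi+2Ric=\mu g$ with $H^\phi$ the Hessian of $\phi$), where $\mu=2\lambda-(p+\frac2n)$ with $\lambda$ a real constant (soliton constant) and $p$ a scalar field (conformal pressure). $(M,g)$ is Ricci flat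 if $Ric=0$ and Einstein if $Ric=\beta g$ for a constant $\beta$.
   Formalization: Part (1) is proved for fiber dimension n ≥ 2 only; for n = 1 it is false as printed: with F the real line, I = (0, π/2), f = tan t and p = 2λ − 2 − 2f′, all hypotheses hold but Ric = 2f′g is not zero. *)

theory Defs
  imports "HOL-Analysis.Analysis"
begin

section \<open>Smooth maps between Euclidean spaces\<close>

primrec Ck_on :: "nat \<Rightarrow> 'e::euclidean_space set \<Rightarrow> ('e \<Rightarrow> 'b::euclidean_space) \<Rightarrow> bool" where
  "Ck_on 0 S f \<longleftrightarrow> continuous_on S f"
| "Ck_on (Suc k) S f \<longleftrightarrow>
     (\<forall>x\<in>S. f differentiable (at x)) \<and> (\<forall>v. Ck_on k S (\<lambda>x. frechet_derivative f (at x) v))"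

text \<open>Only meant for open \<open>S\<close>, since the derivatives are two-sided.\<close>

definition smooth_on :: "'e::euclidean_space set \<Rightarrow> ('e \<Rightarrow> 'b::euclidean_space) \<Rightarrow> bool" where
  "smooth_on S f \<longleftrightarrow> (\<forall>k. Ck_on k S f)"


section \<open>Smooth manifolds\<close>

text \<open>
  A manifold is a topological space with an indexed family of charts with values in the
  Euclidean space \<open>'e\<close>, so that its dimension is \<open>DIM('e)\<close>. The atlas is not
  assumed to be maximal. Outside \<open>chart_dom M i\<close> the values of \<open>chart_map M i\<close> are irrelevant.
\<close>

record ('a, 'e, 'i) manifold =
  mtop :: "'a topology"
  atlas :: "'i set"
  chart_dom :: "'i \<Rightarrow> 'a set"
  chart_map :: "'i \<Rightarrow> 'a \<Rightarrow> 'e"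

definition chart_img :: "('a, 'e, 'i) manifold \<Rightarrow> 'i \<Rightarrow> 'e set" where
  "chart_img M i = chart_map M i ` chart_dom M i"

definition chart_inv :: "('a, 'e, 'i) manifold \<Rightarrow> 'i \<Rightarrow> 'e \<Rightarrow> 'a" where
  "chart_inv M i = inv_into (chart_dom M i) (chart_map M i)"

definition smooth_manifold :: "('a, 'e::euclidean_space, 'i) manifold \<Rightarrow> bool" where
  "smooth_manifold M \<longleftrightarrow>
     Hausdorff_space (mtop M) \<and> second_countable (mtop M) \<and>
     (\<Union>i\<in>atlas M. chart_dom M i) = topspace (mtop M) \<and>
     (\<forall>i\<in>atlas M.
        openin (mtop M) (chart_dom M i) \<and> open (chart_img M i) \<and>
        homeomorphic_map (subtopology (mtop M) (chart_dom M i)) (top_of_set (chart_img M i))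
          (chart_map M i)) \<and>
     (\<forall>i\<in>atlas M. \<forall>j\<in>atlas M.
        smooth_on (chart_map M i ` (chart_dom M i \<inter> chart_dom M j))
          (chart_map M j \<circ> chart_inv M i))"

definition smooth_scalar_field :: "('a, 'e::euclidean_space, 'i) manifold \<Rightarrow> ('a \<Rightarrow> real) \<Rightarrow> bool" where
  "smooth_scalar_field M h \<longleftrightarrow> (\<forall>i\<in>atlas M. smooth_on (chart_img M i) (h \<circ> chart_inv M i))"

text \<open>
  Derivative at the point \<open>q\<close> of a function on the manifold along the coordinate vector field of
  the chart \<open>i\<close> with constant components \<open>u\<close>. For a basis vector \<open>u\<close> this is the partial
  derivative with respect to the corresponding local coordinate.
\<close>

definition pd :: "('a, 'e::euclidean_space, 'i) manifold \<Rightarrow> 'i \<Rightarrow> ('a \<Rightarrow> 'b::real_normed_vector)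
    \<Rightarrow> 'a \<Rightarrow> 'e \<Rightarrow> 'b" where
  "pd M i h q u = frechet_derivative (h \<circ> chart_inv M i) (at (chart_map M i q)) u"


section \<open>Tensor fields and metrics\<close>

text \<open>
  A vector field is given by its components \<open>X i q\<close> at \<open>q\<close> in the chart \<open>i\<close>, and a covariant
  2-tensor field by the bilinear forms \<open>T i q\<close> that represent it in the coordinate frame of the
  chart \<open>i\<close>. The forms of two charts are related by the derivative of the change of coordinates.
\<close>

type_synonym ('a, 'e, 'i) vector_field = "'i \<Rightarrow> 'a \<Rightarrow> 'e"
type_synonym ('a, 'e, 'i) tensor02 = "'i \<Rightarrow> 'a \<Rightarrow> 'e \<Rightarrow> 'e \<Rightarrow> real"

definition smooth_tensor02 :: "('a, 'e::euclidean_space, 'i) manifold \<Rightarrow> ('a, 'e, 'i) tensor02 \<Rightarrow> bool"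
  where
  "smooth_tensor02 M T \<longleftrightarrow>
     (\<forall>i\<in>atlas M. \<forall>q\<in>chart_dom M i. bilinear (T i q)) \<and>
     (\<forall>i\<in>atlas M. \<forall>u v. smooth_on (chart_img M i) ((\<lambda>q. T i q u v) \<circ> chart_inv M i)) \<and>
     (\<forall>i\<in>atlas M. \<forall>j\<in>atlas M. \<forall>q\<in>chart_dom M i \<inter> chart_dom M j. \<forall>u v.
        T i q u v = T j q (pd M i (chart_map M j) q u) (pd M i (chart_map M j) q v))"

definition riemannian_metric :: "('a, 'e::euclidean_space, 'i) manifold \<Rightarrow> ('a, 'e, 'i) tensor02 \<Rightarrow> bool"
  where
  "riemannian_metric M g \<longleftrightarrow>
     smooth_tensor02 M g \<and>
     (\<forall>i\<in>atlas M. \<forall>q\<in>chart_dom M i.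
        (\<forall>u v. g i q u v = g i q v u) \<and> (\<forall>u. u \<noteq> 0 \<longrightarrow> 0 < g i q u u))"

text \<open>
  The following notions make sense for every nondegenerate symmetric \<open>g\<close>, of any signature;
  nondegeneracy is what makes the definite descriptions well-defined.
\<close>

definition gradient :: "('a, 'e::euclidean_space, 'i) manifold \<Rightarrow> ('a, 'e, 'i) tensor02
    \<Rightarrow> ('a \<Rightarrow> real) \<Rightarrow> ('a, 'e, 'i) vector_field" where
  "gradient M g h i q = (THE X. \<forall>v. g i q X v = pd M i h q v)"

text \<open>In coordinates: \<open>X^k \<partial>_k T_ab + T_kb \<partial>_a X^k + T_ak \<partial>_b X^k\<close>.\<close>

definition lie_derivative :: "('a, 'e::euclidean_space, 'i) manifold \<Rightarrow> ('a, 'e, 'i) vector_field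
    \<Rightarrow> ('a, 'e, 'i) tensor02 \<Rightarrow> ('a, 'e, 'i) tensor02" where
  "lie_derivative M X T i q u v =
     pd M i (\<lambda>r. T i r u v) q (X i q)
     + T i q (pd M i (X i) q u) v + T i q u (pd M i (X i) q v)"

text \<open>
  The Levi-Civita connection in a chart: \<open>christoffel M g i q u v\<close> are the components of the covariant
  derivative at \<open>q\<close> of the constant-component field \<open>v\<close> along \<open>u\<close>. The defining equation is the
  Koszul formula for (commuting) coordinate vector fields.
\<close>

definition christoffel :: "('a, 'e::euclidean_space, 'i) manifold \<Rightarrow> ('a, 'e, 'i) tensor02
    \<Rightarrow> 'i \<Rightarrow> 'a \<Rightarrow> 'e \<Rightarrow> 'e \<Rightarrow> 'e" where
  "christoffel M g i q u v =
     (THE w. \<forall>z. 2 * g i q w z =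
        pd M i (\<lambda>r. g i r v z) q u + pd M i (\<lambda>r. g i r u z) q v - pd M i (\<lambda>r. g i r u v) q z)"

text \<open>
  Sign conventions: \<open>R(u,v)w = \<nabla>_u \<nabla>_v w - \<nabla>_v \<nabla>_u w\<close> on coordinate fields, and \<open>Ric(v,w)\<close> is the
  trace of \<open>u \<mapsto> R(u,v)w\<close>, so that round spheres have positive Ricci curvature.
\<close>

definition curvature :: "('a, 'e::euclidean_space, 'i) manifold \<Rightarrow> ('a, 'e, 'i) tensor02
    \<Rightarrow> 'i \<Rightarrow> 'a \<Rightarrow> 'e \<Rightarrow> 'e \<Rightarrow> 'e \<Rightarrow> 'e" where
  "curvature M g i q u v w =
     pd M i (\<lambda>r. christoffel M g i r v w) q u - pd M i (\<lambda>r. christoffel M g i r u w) q v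
     + christoffel M g i q u (christoffel M g i q v w)
     - christoffel M g i q v (christoffel M g i q u w)"

definition ricci :: "('a, 'e::euclidean_space, 'i) manifold \<Rightarrow> ('a, 'e, 'i) tensor02
    \<Rightarrow> ('a, 'e, 'i) tensor02" where
  "ricci M g i q v w = (\<Sum>b\<in>Basis. curvature M g i q b v w \<bullet> b)"

definition ricci_flat :: "('a, 'e::euclidean_space, 'i) manifold \<Rightarrow> ('a, 'e, 'i) tensor02 \<Rightarrow> bool" where
  "ricci_flat M g \<longleftrightarrow> (\<forall>i\<in>atlas M. \<forall>q\<in>chart_dom M i. \<forall>u v. ricci M g i q u v = 0)"

definition einstein :: "('a, 'e::euclidean_space, 'i) manifold \<Rightarrow> ('a, 'e, 'i) tensor02 \<Rightarrow> bool" where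
  "einstein M g \<longleftrightarrow>
     (\<exists>\<beta>::real. \<forall>i\<in>atlas M. \<forall>q\<in>chart_dom M i. \<forall>u v. ricci M g i q u v = \<beta> * g i q u v)"

definition conformal_gradient_ricci_soliton :: "('a, 'e::euclidean_space, 'i) manifold
    \<Rightarrow> ('a, 'e, 'i) tensor02 \<Rightarrow> ('a \<Rightarrow> real) \<Rightarrow> ('a \<Rightarrow> real) \<Rightarrow> bool" where
  "conformal_gradient_ricci_soliton M g \<mu> \<phi> \<longleftrightarrow>
     (\<forall>i\<in>atlas M. \<forall>q\<in>chart_dom M i. \<forall>u v.
        lie_derivative M (gradient M g \<phi>) g i q u v + 2 * ricci M g i q u v = \<mu> q * g i q u v)"


section \<open>Generalized Robertson-Walker spacetimes\<close>

text \<open>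
  The product of the interval \<open>I\<close> (with its identity chart) and \<open>F\<close>. The product chart
  \<open>(t, x) \<mapsto> (t, c x)\<close> is indexed by the index of the chart \<open>c\<close> of \<open>F\<close>.
\<close>

definition grw_manifold :: "real set \<Rightarrow> ('a, 'e, 'i) manifold \<Rightarrow> (real \<times> 'a, real \<times> 'e, 'i) manifold"
  where
  "grw_manifold I F =
     \<lparr> mtop = prod_topology (top_of_set I) (mtop F),
       atlas = atlas F,
       chart_dom = (\<lambda>i. I \<times> chart_dom F i),
       chart_map = (\<lambda>i (t, x). (t, chart_map F i x)) \<rparr>"

text \<open>
  In a product chart the differentials of the two projections are the projections
  \<open>(a, u) \<mapsto> a\<close> and \<open>(a, u) \<mapsto> u\<close>, so the formula below is \<open>- \<pi>^* dt^2 + (f o \<pi>)^2 \<sigma>^* gF\<close>.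

  A one-dimensional fiber is exceptional: for \<open>f = tan\<close> on \<open>(0, pi/2)\<close> and fiber the real line,
  \<open>Ric = 2 f' g\<close>, which does not vanish, while the gradient of a primitive \<open>\<phi>\<close> of \<open>f\<close> satisfies
  \<open>L g = - 2 f' g\<close>. This is a conformal gradient Ricci soliton with
  \<open>p = 2 \<lambda> - 2 - 2 f'\<close>, that is \<open>\<lambda> = f' + p/2 + 1/n\<close> with \<open>n = 1\<close>.
\<close>

definition grw_metric :: "(real \<Rightarrow> real) \<Rightarrow> ('a, 'e, 'i) tensor02
    \<Rightarrow> (real \<times> 'a, real \<times> 'e, 'i) tensor02" where
  "grw_metric f gF = (\<lambda>i (t, x) (a, u) (b, v). - (a * b) + (f t)\<^sup>2 * gF i x u v)"

end

theory Submission
  imports Defs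
begin

text \<open>
  The gradient of \<open>\<phi>\<close> is \<open>- f \<partial>_t\<close>, since \<open>d\<phi> = f dt\<close> and \<open>dt\<close> is dual to \<open>- \<partial>_t\<close>. This is a
  closed conformal vector field: its Lie derivative of \<open>g\<close> is \<open>- 2 f' g\<close>. The soliton equation
  therefore says that \<open>Ric = (\<mu> / 2 + f') g\<close>. On the other hand the Ricci tensor of a warped product
  can be computed; in the time and the fiber directions it is
    \<open>Ric(\<partial>_t, \<partial>_t) = - n f'' / f\<close> and
    \<open>Ric(v, w) = Ric_F(v, w) + (f f'' + (n - 1) f'^2) g_F(v, w)\<close>.

  If \<open>f\<close> is affine, then \<open>Ric(\<partial>_t, \<partial>_t) = 0\<close>, which forces the factor \<open>\<mu> / 2 + f'\<close> to vanish,
  because \<open>g(\<partial>_t, \<partial>_t) = -1\<close>. So \<open>Ric = 0\<close>, and \<open>M\<close> is Einstein with constant \<open>0\<close>.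

  Under the relation between \<open>\<lambda>\<close>, \<open>f'\<close> and \<open>p\<close> the factor is \<open>2 f'\<close>, and it has to be shown that
  \<open>f' = 0\<close>. The time direction gives \<open>n f'' = 2 f f'\<close>, so \<open>n f' - f^2\<close> is a constant \<open>c\<close>.
  In a fiber direction \<open>v\<close> at a fixed point of \<open>F\<close>, the number \<open>Ric_F(v, v) / g_F(v, v)\<close> does not depend
  on \<open>t\<close>, so that \<open>2 f' f^2 - f f'' - (n - 1) f'^2\<close> is constant. Eliminating \<open>f'\<close> and
  \<open>f''\<close> turns this into \<open>(n - 1) (f^4 - c^2) / n^2\<close>. Since \<open>n \<ge> 2\<close>, \<open>f\<close> is constant
  (\<open>static_warping\<close>).

  The Ricci tensor comes from the explicit Christoffel symbols of the product chart
  (\<open>christoffel_grw\<close>), which are those of the fiber plus terms in \<open>f\<close>. Differentiating them requires that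
  the fiber symbols are differentiable. They solve a linear equation whose coefficients are the metric, and
  solutions of such equations inherit differentiability (\<open>differentiable_solution\<close>).
\<close>

section \<open>Solving equations for nondegenerate bilinear forms\<close>

text \<open>
  The operator that represents \<open>B\<close> with respect to the inner product of the coordinate space. It turns an
  equation \<open>B w = L\<close> between linear forms into an equation between vectors.
\<close>

definition form_operator :: "('e::euclidean_space \<Rightarrow> 'e \<Rightarrow> real) \<Rightarrow> 'e \<Rightarrow> 'e" where
  "form_operator B w = (\<Sum>b\<in>Basis. B w b *\<^sub>R b)"

lemma form_operator_inner_Basis: "b \<in> Basis \<Longrightarrow> form_operator B w \<bullet> b = B w b"
  by (simp add: form_operator_def)

lemma linear_form_operator:
  assumes "bilinear B"
  shows "linear (form_operator B)"
  by (rule linearI)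
     (simp_all add: form_operator_def bilinear_ladd[OF assms] bilinear_lmul[OF assms]
        scaleR_left_distrib sum.distrib scaleR_sum_right)

lemma form_operator_eqD:
  assumes "bilinear B" and "linear L" and "form_operator B w = (\<Sum>b\<in>Basis. L b *\<^sub>R b)"
  shows "B w z = L z"
proof -
  have "linear (B w)" using assms(1) by (simp add: bilinear_def)
  moreover have "B w b = L b" if "b \<in> Basis" for b
    using form_operator_inner_Basis[OF that, of B w] that by (simp add: assms(3))
  ultimately show ?thesis using assms(2) by (metis linear_eq_stdbasis)
qed

lemma inj_form_operator:
  assumes B: "bilinear B" and nd: "\<And>w. (\<And>z. B w z = 0) \<Longrightarrow> w = 0"
  shows "inj (form_operator B)"
proof (subst linear_injective_0[OF linear_form_operator[OF B]], intro allI impI)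
  fix w assume "form_operator B w = 0"
  then have "B w z = 0" for z
    by (intro form_operator_eqD[OF B linear_zero]) simp
  then show "w = 0" by (rule nd)
qed

text \<open>
  A nondegenerate form gives an injective operator, which is surjective for reasons of dimension. This
  is what gives the definite description in the Christoffel symbols a value.
\<close>

lemma linear_form_representation:
  fixes B :: "'e::euclidean_space \<Rightarrow> 'e \<Rightarrow> real"
  assumes B: "bilinear B" and nd: "\<And>w. (\<And>z. B w z = 0) \<Longrightarrow> w = 0" and L: "linear L"
  shows "\<exists>!w. \<forall>z. B w z = L z"
proof -
  have "surj (form_operator B)"
    using linear_form_operator[OF B] inj_form_operator[OF B nd] by (rule linear_injective_imp_surjective[OF _ _ refl])
  then obtain w where "form_operator B w = (\<Sum>b\<in>Basis. L b *\<^sub>R b)"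
    by (metis surjD)
  then have w: "B w z = L z" for z
    by (rule form_operator_eqD[OF B L])
  moreover have "w' = w" if "\<forall>z. B w' z = L z" for w'
    using nd[of "w' - w"] that w by (simp add: bilinear_lsub[OF B])
  ultimately show ?thesis by (intro ex1I[of _ w]) auto
qed

text \<open>
  The product rule when one factor is merely continuous: the increment of \<open>a\<close> only multiplies
  \<open>e x\<close>, which is of order \<open>x - y\<close> because \<open>e\<close> vanishes at \<open>y\<close>.
\<close>

lemma has_derivative_scaleR_vanishing:
  fixes a :: "'e::real_normed_vector \<Rightarrow> real" and e :: "'e \<Rightarrow> 'b::real_normed_vector"
  assumes a: "isCont a y" and e: "(e has_derivative e') (at y)" and e0: "e y = 0"
  shows "((\<lambda>x. a x *\<^sub>R e x) has_derivative (\<lambda>h. a y *\<^sub>R e' h)) (at y)"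
proof (rule has_derivativeI)
  have bl: "bounded_linear e'" using e by (rule has_derivative_bounded_linear)
  then show "bounded_linear (\<lambda>h. a y *\<^sub>R e' h)"
    by (rule bounded_linear_compose[OF bounded_linear_scaleR_right])
  obtain K where K: "\<And>h. norm (e' h) \<le> norm h * K"
    using bounded_linear.bounded[OF bl] by auto
  have lim: "((\<lambda>x. ((e x - e y) - e' (x - y)) /\<^sub>R norm (x - y)) \<longlongrightarrow> 0) (at y)"
    using e by (simp add: has_derivative_at_within)
  have a_lim: "(a \<longlongrightarrow> a y) (at y)" using a by (simp add: isCont_def)
  have "((\<lambda>x. (a x - a y) *\<^sub>R (e' (x - y) /\<^sub>R norm (x - y))) \<longlongrightarrow> 0) (at y)"
  proof (rule Lim_null_comparison)
    show "\<forall>\<^sub>F x in at y. norm ((a x - a y) *\<^sub>R (e' (x - y) /\<^sub>R norm (x - y))) \<le> \<bar>a x - a y\<bar> * \<bar>K\<bar>"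
    proof (intro always_eventually allI)
      fix x
      have "norm (e' (x - y) /\<^sub>R norm (x - y)) \<le> \<bar>K\<bar>"
        using K[of "x - y"] by (cases "x = y") (auto simp: field_simps intro: order_trans)
      then show "norm ((a x - a y) *\<^sub>R (e' (x - y) /\<^sub>R norm (x - y))) \<le> \<bar>a x - a y\<bar> * \<bar>K\<bar>"
        by (simp add: mult_left_mono del: scaleR_scaleR norm_inverse)
    qed
    show "((\<lambda>x. \<bar>a x - a y\<bar> * \<bar>K\<bar>) \<longlongrightarrow> 0) (at y)"
      by (rule tendsto_eq_intros a_lim refl | simp)+
  qed
  moreover have "((\<lambda>x. a x *\<^sub>R (((e x - e y) - e' (x - y)) /\<^sub>R norm (x - y))) \<longlongrightarrow> a y *\<^sub>R 0) (at y)"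
    by (intro tendsto_scaleR a_lim lim)
  ultimately have "((\<lambda>x. a x *\<^sub>R (((e x - e y) - e' (x - y)) /\<^sub>R norm (x - y))
      + (a x - a y) *\<^sub>R (e' (x - y) /\<^sub>R norm (x - y))) \<longlongrightarrow> a y *\<^sub>R 0 + 0) (at y)"
    by (intro tendsto_add)
  then show "((\<lambda>x. ((a x *\<^sub>R e x - a y *\<^sub>R e y) - a y *\<^sub>R e' (x - y)) /\<^sub>R norm (x - y)) \<longlongrightarrow> 0) (at y)"
    by (simp add: e0 algebra_simps)
qed

text \<open>
  Let \<open>P\<close> invert the operator of the form at \<open>y0\<close>. The equation becomes a fixed-point equation
  \<open>w y = P (l y) - E y (w y)\<close>, where the linear map \<open>E y\<close> (given by its values \<open>E c y\<close>
  on the basis) depends differentiably on \<open>y\<close>, and \<open>E y0 = 0\<close>. As \<open>E y\<close> is small near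
  \<open>y0\<close>, the equation first bounds \<open>w\<close>, then shows that \<open>w\<close> is continuous at \<open>y0\<close>, and then that it is
  differentiable there, because \<open>E y (w y)\<close> is a sum of products of a continuous function with a
  differentiable function that vanishes at \<open>y0\<close>.
\<close>

lemma differentiable_solution:
  fixes B :: "'d::euclidean_space \<Rightarrow> 'e::euclidean_space \<Rightarrow> 'e \<Rightarrow> real" and w :: "'d \<Rightarrow> 'e"
  assumes U: "open U" "y0 \<in> U" and B: "\<And>y. y \<in> U \<Longrightarrow> bilinear (B y)"
    and nd: "\<And>w. (\<And>z. B y0 w z = 0) \<Longrightarrow> w = 0"
    and dB: "\<And>u v. (\<lambda>y. B y u v) differentiable (at y0)"
    and dL: "\<And>z. (\<lambda>y. L y z) differentiable (at y0)"
    and eq: "\<And>y z. y \<in> U \<Longrightarrow> B y (w y) z = L y z"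
  shows "w differentiable (at y0)"
proof -
  define A where "A y w = (\<Sum>b\<in>Basis. B y w b *\<^sub>R b)" for y w
  define l where "l y = (\<Sum>b\<in>Basis. L y b *\<^sub>R b)" for y
  have A_eq: "A y = form_operator (B y)" for y
    by (rule ext) (simp add: A_def form_operator_def)
  have linA: "linear (A y)" if "y \<in> U" for y
    unfolding A_eq by (rule linear_form_operator[OF B[OF that]])
  have Aw: "A y (w y) = l y" if "y \<in> U" for y
    using that by (simp add: A_def l_def eq)
  have "inj (A y0)"
    unfolding A_eq by (rule inj_form_operator[OF B[OF U(2)] nd])
  then obtain P where P: "linear P" "P \<circ> A y0 = id"
    using linear_injective_left_inverse[OF linA[OF U(2)]] by blast
  have blP: "bounded_linear P" using P(1) by (simp add: linear_conv_bounded_linear)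
  have PA: "P (A y0 v) = v" for v using P(2) by (metis comp_apply id_apply)
  define E where "E c y = P (A y c - A y0 c)" for c y
  have dA: "(\<lambda>y. A y c) differentiable (at y0)" for c
    unfolding A_def by (intro differentiable_sum ballI differentiable_scaleR dB finite_Basis differentiable_const)
  have dP: "(\<lambda>y. P (g y)) differentiable (at y0)" if "g differentiable (at y0)" for g :: "'d \<Rightarrow> 'e"
    using that bounded_linear.has_derivative[OF blP] unfolding differentiable_def by blast
  have dE: "E c differentiable (at y0)" for c
    unfolding E_def by (intro dP differentiable_diff dA differentiable_const)
  have E0: "E c y0 = 0" for c by (simp add: E_def linear_0[OF P(1)])
  have dl: "(\<lambda>y. P (l y)) differentiable (at y0)"
    unfolding l_def by (intro dP differentiable_sum ballI differentiable_scaleR dL finite_Basis differentiable_const)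
  have fp: "w y = P (l y) - (\<Sum>c\<in>Basis. (w y \<bullet> c) *\<^sub>R E c y)" if "y \<in> U" for y
  proof -
    have "(\<Sum>c\<in>Basis. (w y \<bullet> c) *\<^sub>R E c y) = P (\<Sum>c\<in>Basis. (w y \<bullet> c) *\<^sub>R (A y c - A y0 c))"
      by (simp add: E_def linear_sum[OF P(1)] linear_cmul[OF P(1)])
    also have "(\<Sum>c\<in>Basis. (w y \<bullet> c) *\<^sub>R (A y c - A y0 c))
        = A y (\<Sum>c\<in>Basis. (w y \<bullet> c) *\<^sub>R c) - A y0 (\<Sum>c\<in>Basis. (w y \<bullet> c) *\<^sub>R c)"
      using linA[OF that] linA[OF U(2)]
      by (simp add: linear_sum linear_cmul scaleR_diff_right sum_subtractf)
    also have "\<dots> = l y - A y0 (w y)" by (simp add: euclidean_representation Aw[OF that])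
    finally show ?thesis by (simp add: linear_diff[OF P(1)] PA)
  qed
  have Uev: "\<forall>\<^sub>F y in at y0. y \<in> U" using U by (simp add: eventually_at_in_open')
  have Elim: "((\<lambda>y. E c y) \<longlongrightarrow> 0) (at y0)" for c
    using differentiable_imp_continuous_within[OF dE[of c]] by (simp add: continuous_within E0)
  have Pllim: "((\<lambda>y. P (l y)) \<longlongrightarrow> w y0) (at y0)"
    using differentiable_imp_continuous_within[OF dl]
    by (simp add: continuous_within Aw[OF U(2), symmetric] PA)
  define s where "s y = (\<Sum>c\<in>Basis. norm (E c y))" for y
  have slim: "(s \<longlongrightarrow> 0) (at y0)"
    unfolding s_def by (rule tendsto_null_sum) (rule tendsto_norm_zero[OF Elim])
  have bnd: "norm (\<Sum>c\<in>Basis. (w y \<bullet> c) *\<^sub>R E c y) \<le> norm (w y) * s y" for y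
    unfolding s_def sum_distrib_left
    by (intro sum_norm_le) (auto intro!: mult_right_mono Basis_le_norm)
  \<comment> \<open>Where the correction term has norm at most half of that of \<open>w y\<close>, it can be absorbed on the left.\<close>
  have "\<forall>\<^sub>F y in at y0. s y < 1/2" by (rule order_tendstoD(2)[OF slim]) simp
  then have wbound: "\<forall>\<^sub>F y in at y0. norm (w y) \<le> 2 * norm (P (l y))"
    using Uev
  proof eventually_elim
    case (elim y)
    have "norm (w y) \<le> norm (P (l y)) + norm (w y) * s y"
      using norm_triangle_ineq4[of "P (l y)" "\<Sum>c\<in>Basis. (w y \<bullet> c) *\<^sub>R E c y"] bnd[of y] fp[OF elim(2)]
      by simp
    also have "norm (w y) * s y \<le> norm (w y) * (1/2)"
      using elim(1) by (intro mult_left_mono) auto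
    finally show ?case by simp
  qed
  have "((\<lambda>y. \<Sum>c\<in>Basis. (w y \<bullet> c) *\<^sub>R E c y) \<longlongrightarrow> 0) (at y0)"
  proof (rule Lim_null_comparison)
    show "\<forall>\<^sub>F y in at y0. norm (\<Sum>c\<in>Basis. (w y \<bullet> c) *\<^sub>R E c y) \<le> 2 * norm (P (l y)) * s y"
      using wbound
    proof eventually_elim
      case (elim y)
      have "0 \<le> s y" by (simp add: s_def sum_nonneg)
      then show ?case using bnd[of y] elim by (meson mult_right_mono order_trans)
    qed
    show "((\<lambda>y. 2 * norm (P (l y)) * s y) \<longlongrightarrow> 0) (at y0)"
      by (rule tendsto_eq_intros Pllim slim refl | simp)+
  qed
  with Pllim have "((\<lambda>y. P (l y) - (\<Sum>c\<in>Basis. (w y \<bullet> c) *\<^sub>R E c y)) \<longlongrightarrow> w y0 - 0) (at y0)"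
    by (intro tendsto_diff)
  moreover have "\<forall>\<^sub>F y in at y0. P (l y) - (\<Sum>c\<in>Basis. (w y \<bullet> c) *\<^sub>R E c y) = w y"
    using Uev by eventually_elim (simp add: fp[symmetric])
  ultimately have "(w \<longlongrightarrow> w y0 - 0) (at y0)"
    by (rule Lim_transform_eventually)
  then have wcont: "isCont (\<lambda>y. w y \<bullet> c) y0" for c
    by (simp add: isCont_def tendsto_inner)
  have "(\<lambda>y. (w y \<bullet> c) *\<^sub>R E c y) differentiable (at y0)" for c
    using has_derivative_scaleR_vanishing[where e = "E c", OF wcont[of c] _ E0] dE[of c]
    unfolding differentiable_def by blast
  then have "(\<lambda>y. P (l y) - (\<Sum>c\<in>Basis. (w y \<bullet> c) *\<^sub>R E c y)) differentiable (at y0)"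
    by (intro differentiable_diff differentiable_sum ballI dl) auto
  then obtain D where "((\<lambda>y. P (l y) - (\<Sum>c\<in>Basis. (w y \<bullet> c) *\<^sub>R E c y)) has_derivative D) (at y0)"
    by (auto simp: differentiable_def)
  then have "(w has_derivative D) (at y0)"
    by (rule has_derivative_transform_within_open[OF _ U]) (simp add: fp[symmetric])
  then show ?thesis by (auto simp: differentiable_def)
qed

section \<open>Calculus in charts and on the line\<close>

lemma smooth_on_twice_differentiable:
  assumes "smooth_on S h" "x \<in> S"
  shows "h differentiable (at x)"
    and "(\<lambda>y. frechet_derivative h (at y) v) differentiable (at x)"
proof -
  have "Ck_on (Suc (Suc 0)) S h" using assms(1) by (simp only: smooth_on_def)
  with assms(2) show "h differentiable (at x)"
    and "(\<lambda>y. frechet_derivative h (at y) v) differentiable (at x)"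
    by auto
qed

text \<open>
  The inverse of a chart has arbitrary values outside the image of the chart, so that a coordinate
  expression is only known near the point, which is enough for its derivative.
\<close>

lemma pd_eqI:
  assumes "(H has_derivative D) (at (chart_map M i q))" and "open S" and "chart_map M i q \<in> S"
    and "\<And>y. y \<in> S \<Longrightarrow> H y = h (chart_inv M i y)"
  shows "pd M i h q = D"
proof -
  have "((h \<circ> chart_inv M i) has_derivative D) (at (chart_map M i q))"
    by (rule has_derivative_transform_within_open[OF assms(1-3)]) (simp add: assms(4))
  then show ?thesis by (auto simp: pd_def fun_eq_iff frechet_derivative_at[symmetric])
qed

lemma has_derivative_fst_pullback:
  assumes "(h has_real_derivative d) (at (fst z))"
  shows "((\<lambda>z. h (fst z)) has_derivative (\<lambda>k. d * fst k)) (at z)"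
  using has_derivative_compose[OF has_derivative_fst[OF has_derivative_ident] assms[unfolded has_field_derivative_def]]
  by simp

lemma has_derivative_snd_pullback:
  assumes "(h has_derivative D) (at (snd z))"
  shows "((\<lambda>z. h (snd z)) has_derivative (\<lambda>k. D (snd k))) (at z)"
  using has_derivative_compose[OF has_derivative_snd[OF has_derivative_ident] assms]
  by simp

lemma has_derivative_mult_pullback:
  fixes G :: "'b::real_normed_vector \<Rightarrow> real"
  assumes "(h has_real_derivative d) (at t)" and "(G has_derivative D) (at y)"
  shows "((\<lambda>z. h (fst z) * G (snd z)) has_derivative (\<lambda>k. h t * D (snd k) + d * fst k * G y)) (at (t, y))"
  using has_derivative_mult[OF has_derivative_fst_pullback[where z = "(t, y)", simplified, OF assms(1)]
      has_derivative_snd_pullback[where z = "(t, y)", simplified, OF assms(2)]]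
  by simp

lemma differentiable_real_deriv:
  fixes h :: "real \<Rightarrow> real"
  assumes "h differentiable (at t)"
  shows "(h has_real_derivative deriv h t) (at t)" and "deriv h t = frechet_derivative h (at t) 1"
proof -
  show *: "(h has_real_derivative deriv h t) (at t)"
    using assms DERIV_deriv_iff_real_differentiable by blast
  show "deriv h t = frechet_derivative h (at t) 1"
    using frechet_derivative_at[OF *[unfolded has_field_derivative_def]] by (metis mult.right_neutral)
qed

lemma smooth_on_real_derivs:
  fixes h :: "real \<Rightarrow> real"
  assumes "smooth_on S h" "open S" "t \<in> S"
  shows "(h has_real_derivative deriv h t) (at t)"
    and "(deriv h has_real_derivative deriv (deriv h) t) (at t)"
proof -
  have d: "h differentiable (at s)" if "s \<in> S" for s
    using smooth_on_twice_differentiable(1)[OF assms(1) that] .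
  from d[OF assms(3)] show "(h has_real_derivative deriv h t) (at t)"
    by (rule differentiable_real_deriv)
  obtain D where D: "((\<lambda>y. frechet_derivative h (at y) 1) has_derivative D) (at t)"
    using smooth_on_twice_differentiable(2)[OF assms(1,3), of 1] by (auto simp: differentiable_def)
  have "(deriv h has_derivative D) (at t)"
    by (rule has_derivative_transform_within_open[OF D assms(2,3)])
       (simp add: differentiable_real_deriv(2) d)
  then show "(deriv h has_real_derivative deriv (deriv h) t) (at t)"
    by (intro differentiable_real_deriv) (auto simp: differentiable_def)
qed

lemma sum_Basis_prod:
  fixes h :: "'a::euclidean_space \<times> 'b::euclidean_space \<Rightarrow> 'c::comm_monoid_add"
  shows "sum h Basis = (\<Sum>b\<in>Basis. h (b, 0)) + (\<Sum>b\<in>Basis. h (0, b))"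
proof -
  have "inj_on (\<lambda>u. (u::'a, 0::'b)) Basis" "inj_on (\<lambda>u. (0::'a, u::'b)) Basis"
    by (auto intro!: inj_onI)
  then show ?thesis
    unfolding Basis_prod_def by (subst sum.union_disjoint) (auto simp: sum.reindex)
qed

text \<open>
  The fundamental theorem of calculus is applied on a compact subinterval of \<open>I\<close> that contains \<open>c\<close>
  and has \<open>t\<close> in its interior, where the derivative relative to the interval is the two-sided one.
\<close>

lemma interval_integral_has_derivative:
  fixes f :: "real \<Rightarrow> real"
  assumes I: "open I" "is_interval I" and f: "continuous_on I f" and c: "c \<in> I" and t: "t \<in> I"
  shows "((\<lambda>s. LBINT z=ereal c..ereal s. f z) has_real_derivative f t) (at t)"
proof -
  obtain d where d: "0 < d" "cball t d \<subseteq> I"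
    using I(1) t open_contains_cball by blast
  define a where "a = min c (t - d)"
  define b where "b = max c (t + d)"
  have "t - d \<in> I" "t + d \<in> I"
    using d by (auto simp: dist_real_def subset_iff)
  then have "a \<in> I" "b \<in> I" using c by (auto simp: a_def b_def min_def max_def)
  then have sub: "{a..b} \<subseteq> I"
    using mem_is_interval_1_I[OF I(2)] by (meson atLeastAtMost_iff subsetI)
  have "((\<lambda>s. LBINT z=ereal c..ereal s. f z) has_vector_derivative f t) (at t within {a..b})"
    by (rule interval_integral_FTC2)
       (use d continuous_on_subset[OF f sub] in \<open>auto simp: a_def b_def\<close>)
  moreover have "at t within {a..b} = at t"
    using d by (intro at_within_interior) (auto simp: a_def b_def)
  ultimately show ?thesis by (simp add: has_real_derivative_iff_has_vector_derivative)
qed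

section \<open>The Levi-Civita connection of the fiber\<close>

text \<open>
  A single chart suffices: connection, curvature and soliton equation are all expressed chart by chart.
\<close>

locale riemannian_chart =
  fixes F :: "('a, 'e::euclidean_space, 'i) manifold" and gF :: "('a, 'e, 'i) tensor02" and i :: 'i
  assumes manifold: "smooth_manifold F" and metric: "riemannian_metric F gF" and chart: "i \<in> atlas F"
begin

lemma chart_open: "open (chart_img F i)"
  using manifold chart by (auto simp: smooth_manifold_def)

lemma inj_chart: "inj_on (chart_map F i) (chart_dom F i)"
proof -
  have "openin (mtop F) (chart_dom F i)"
    "homeomorphic_map (subtopology (mtop F) (chart_dom F i)) (top_of_set (chart_img F i)) (chart_map F i)"
    using manifold chart by (auto simp: smooth_manifold_def)
  then show ?thesis
    using homeomorphic_imp_injective_map openin_subset topspace_subtopology_subset by metis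
qed

lemma chart_inv_map [simp]: "x \<in> chart_dom F i \<Longrightarrow> chart_inv F i (chart_map F i x) = x"
  by (simp add: chart_inv_def inj_chart)

lemma chart_map_inv [simp]: "y \<in> chart_img F i \<Longrightarrow> chart_map F i (chart_inv F i y) = y"
  by (simp add: chart_inv_def chart_img_def f_inv_into_f)

lemma chart_inv_dom [simp]: "y \<in> chart_img F i \<Longrightarrow> chart_inv F i y \<in> chart_dom F i"
  by (simp add: chart_inv_def chart_img_def inv_into_into)

lemma chart_map_img [simp]: "x \<in> chart_dom F i \<Longrightarrow> chart_map F i x \<in> chart_img F i"
  by (simp add: chart_img_def)

lemma bilinear_metric: "x \<in> chart_dom F i \<Longrightarrow> bilinear (gF i x)"
  using metric chart by (simp add: riemannian_metric_def smooth_tensor02_def)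

lemma bilinear_metric_simps [simp]:
  assumes "x \<in> chart_dom F i"
  shows "gF i x 0 v = 0" "gF i x u 0 = 0"
    "gF i x (u + u') v = gF i x u v + gF i x u' v"
    "gF i x u (v + v') = gF i x u v + gF i x u v'"
    "gF i x (c *\<^sub>R u) v = c * gF i x u v"
    "gF i x u (c *\<^sub>R v) = c * gF i x u v"
    "gF i x (u - u') v = gF i x u v - gF i x u' v"
  using bilinear_metric[OF assms]
  by (simp_all add: bilinear_lzero bilinear_rzero bilinear_ladd bilinear_radd bilinear_lmul bilinear_rmul
      bilinear_lsub)

lemma metric_pos: "x \<in> chart_dom F i \<Longrightarrow> u \<noteq> 0 \<Longrightarrow> 0 < gF i x u u"
  using metric chart by (simp add: riemannian_metric_def)

lemma metric_nondegenerate: "x \<in> chart_dom F i \<Longrightarrow> (\<And>z. gF i x w z = 0) \<Longrightarrow> w = 0"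
  using metric_pos[of x w] by force

lemma metric_smooth: "smooth_on (chart_img F i) (\<lambda>y. gF i (chart_inv F i y) u v)"
  using metric chart by (simp add: riemannian_metric_def smooth_tensor02_def o_def)

lemma metric_has_pd:
  assumes "x \<in> chart_dom F i"
  shows "((\<lambda>y. gF i (chart_inv F i y) u v) has_derivative pd F i (\<lambda>r. gF i r u v) x) (at (chart_map F i x))"
proof -
  have "(\<lambda>y. gF i (chart_inv F i y) u v) differentiable at (chart_map F i x)"
    by (rule smooth_on_twice_differentiable(1)[OF metric_smooth]) (simp add: assms)
  then have "((\<lambda>y. gF i (chart_inv F i y) u v) has_derivative
      frechet_derivative (\<lambda>y. gF i (chart_inv F i y) u v) (at (chart_map F i x))) (at (chart_map F i x))"
    by (simp add: frechet_derivative_works)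
  then show ?thesis
    by (simp add: pd_def[abs_def] o_def)
qed

lemma linear_pd_metric: "x \<in> chart_dom F i \<Longrightarrow> linear (pd F i (\<lambda>r. gF i r u v) x)"
  using metric_has_pd has_derivative_linear by blast

lemma pd_metric_linear:
  assumes x: "x \<in> chart_dom F i"
  shows "linear (\<lambda>z. pd F i (\<lambda>r. gF i r u z) x h)"
proof (rule linearI)
  fix v w
  have "pd F i (\<lambda>r. gF i r u (v + w)) x
      = (\<lambda>h. pd F i (\<lambda>r. gF i r u v) x h + pd F i (\<lambda>r. gF i r u w) x h)"
    by (rule pd_eqI[OF has_derivative_add[OF metric_has_pd metric_has_pd] chart_open])
       (use x in \<open>auto simp: bilinear_radd[OF bilinear_metric]\<close>)
  then show "pd F i (\<lambda>r. gF i r u (v + w)) x h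
      = pd F i (\<lambda>r. gF i r u v) x h + pd F i (\<lambda>r. gF i r u w) x h" by simp
next
  fix c v
  have "pd F i (\<lambda>r. gF i r u (c *\<^sub>R v)) x = (\<lambda>h. c * pd F i (\<lambda>r. gF i r u v) x h)"
    by (rule pd_eqI[OF has_derivative_mult_right[OF metric_has_pd] chart_open])
       (use x in \<open>auto simp: bilinear_rmul[OF bilinear_metric]\<close>)
  then show "pd F i (\<lambda>r. gF i r u (c *\<^sub>R v)) x h = c *\<^sub>R pd F i (\<lambda>r. gF i r u v) x h" by simp
qed

text \<open>
  The right-hand side is linear in \<open>z\<close>, so the metric represents it by a vector.
\<close>

lemma koszul_formula:
  assumes x: "x \<in> chart_dom F i"
  shows "2 * gF i x (christoffel F gF i x u v) z =
        pd F i (\<lambda>r. gF i r v z) x u + pd F i (\<lambda>r. gF i r u z) x v - pd F i (\<lambda>r. gF i r u v) x z"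
    (is "_ = ?K z")
proof -
  have "linear (\<lambda>z. (1/2) *\<^sub>R ?K z)"
    by (intro linear_compose_scale_right linear_compose_sub linear_compose_add
        pd_metric_linear linear_pd_metric x)
  then have "linear (\<lambda>z. ?K z / 2)" by simp
  then have "\<exists>!w. \<forall>z. gF i x w z = ?K z / 2"
    by (rule linear_form_representation[rotated 2])
       (auto intro: bilinear_metric metric_nondegenerate x)
  then have "\<exists>!w. \<forall>z. 2 * gF i x w z = ?K z"
    by (simp add: field_simps)
  from theI'[OF this] show ?thesis
    unfolding christoffel_def by blast
qed

text \<open>
  The Koszul formula is a linear equation for the symbols whose coefficients are the metric and its first
  derivatives. As the metric is twice differentiable, \<open>differentiable_solution\<close> applies.
\<close>

lemma christoffel_has_pd:
  assumes x: "x \<in> chart_dom F i"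
  shows "((\<lambda>y. christoffel F gF i (chart_inv F i y) u v) has_derivative
      pd F i (\<lambda>r. christoffel F gF i r u v) x) (at (chart_map F i x))"
proof -
  let ?K = "\<lambda>y z. (pd F i (\<lambda>r. gF i r v z) (chart_inv F i y) u
    + pd F i (\<lambda>r. gF i r u z) (chart_inv F i y) v - pd F i (\<lambda>r. gF i r u v) (chart_inv F i y) z) / 2"
  let ?d = "\<lambda>y v z u. frechet_derivative (\<lambda>y. gF i (chart_inv F i y) v z) (at y) u"
  have y0: "chart_map F i x \<in> chart_img F i" using x by simp
  have "(\<lambda>y. (?d y v z u + ?d y u z v - ?d y u v z) * (1/2)) differentiable at (chart_map F i x)" for z
    by (intro differentiable_mult differentiable_const differentiable_diff differentiable_add
        smooth_on_twice_differentiable(2)[OF metric_smooth] y0)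
  then have "(\<lambda>y. ?K y z) differentiable at (chart_map F i x)" for z
    unfolding differentiable_def
    using has_derivative_transform_within_open[OF _ chart_open y0, of _ _ UNIV "\<lambda>y. ?K y z"]
    by (force simp: pd_def o_def)
  moreover have "gF i (chart_inv F i y) (christoffel F gF i (chart_inv F i y) u v) z = ?K y z"
    if "y \<in> chart_img F i" for y z
    using koszul_formula[OF chart_inv_dom[OF that], of u v z] by simp
  ultimately have "(\<lambda>y. christoffel F gF i (chart_inv F i y) u v) differentiable at (chart_map F i x)"
    using x by (intro differentiable_solution[OF chart_open y0, where B = "\<lambda>y. gF i (chart_inv F i y)" and L = ?K])
       (auto intro: bilinear_metric metric_nondegenerate[OF x]
          smooth_on_twice_differentiable(1)[OF metric_smooth])
  then show ?thesis
    by (simp add: pd_def[abs_def] o_def frechet_derivative_works)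
qed

lemma pd_constant:
  assumes "x \<in> chart_dom F i" and "\<And>r. r \<in> chart_dom F i \<Longrightarrow> h r = c"
  shows "pd F i h x = (\<lambda>_. 0)"
  by (rule pd_eqI[OF has_derivative_const[of c] chart_open]) (use assms in auto)

lemma pd_metric_zero [simp]:
  assumes "x \<in> chart_dom F i"
  shows "pd F i (\<lambda>r. gF i r 0 v) x h = 0" and "pd F i (\<lambda>r. gF i r u 0) x h = 0"
    and "pd F i (\<lambda>r. gF i r u v) x 0 = 0"
  using assms by (simp_all add: pd_constant[where c = 0] linear_0[OF linear_pd_metric])

lemma christoffel_zero [simp]:
  assumes x: "x \<in> chart_dom F i"
  shows "christoffel F gF i x 0 v = 0" and "christoffel F gF i x u 0 = 0"
  using koszul_formula[OF x, of 0 v] koszul_formula[OF x, of u 0] x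
  by (auto intro!: metric_nondegenerate[OF x])

lemma pd_christoffel_zero [simp]:
  assumes "x \<in> chart_dom F i"
  shows "pd F i (\<lambda>r. christoffel F gF i r 0 v) x h = 0" and "pd F i (\<lambda>r. christoffel F gF i r u 0) x h = 0"
  using assms by (simp_all add: pd_constant[where c = 0])

end

section \<open>Connection and curvature of the warped product\<close>

locale grw_chart = riemannian_chart F gF i
  for F :: "('a, 'e::euclidean_space, 'i) manifold" and gF :: "('a, 'e, 'i) tensor02" and i :: 'i +
  fixes I :: "real set" and f :: "real \<Rightarrow> real"
  assumes I_open: "open I" and f_smooth: "smooth_on I f" and f_pos: "t \<in> I \<Longrightarrow> 0 < f t"
begin

abbreviation M where "M \<equiv> grw_manifold I F"
abbreviation g where "g \<equiv> grw_metric f gF"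

lemma M_chart_map [simp]: "chart_map M i (t, x) = (t, chart_map F i x)"
  by (simp add: grw_manifold_def)

lemma M_chart_inv [simp]:
  assumes "t \<in> I" "y \<in> chart_img F i"
  shows "chart_inv M i (t, y) = (t, chart_inv F i y)"
proof -
  have "inj_on (\<lambda>(t, x). (t, chart_map F i x)) (I \<times> chart_dom F i)"
    using inj_chart by (auto simp: inj_on_def)
  then have "inv_into (I \<times> chart_dom F i) (\<lambda>(t, x). (t, chart_map F i x)) (t, y) = (t, chart_inv F i y)"
    by (rule inv_into_f_eq) (use assms in auto)
  then show ?thesis
    unfolding chart_inv_def[of M i] by (simp add: grw_manifold_def)
qed

lemma M_pd_eqI:
  assumes "(H has_derivative D) (at (t, chart_map F i x))" and "t \<in> I" "x \<in> chart_dom F i"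
    and "\<And>s y. s \<in> I \<Longrightarrow> y \<in> chart_img F i \<Longrightarrow> H (s, y) = h (s, chart_inv F i y)"
  shows "pd M i h (t, x) = D"
  by (rule pd_eqI[of H D M i "(t, x)" "I \<times> chart_img F i"])
     (use assms in \<open>auto intro: open_Times I_open chart_open\<close>)

lemmas f_deriv = smooth_on_real_derivs[OF f_smooth I_open]

lemma grw_metric_simps [simp]: "g i (t, x) (a, u) (b, v) = - (a * b) + (f t)\<^sup>2 * gF i x u v"
  by (simp add: grw_metric_def)

text \<open>
  Nondegeneracy of the Lorentzian metric: it determines the time component of a vector by testing against
  \<open>\<partial>_t\<close>, and the fiber component by testing against vectors tangent to \<open>F\<close>. This is the uniqueness that
  is used for the gradient and for the Christoffel symbols.
\<close>

lemma grw_metric_cancel: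
  assumes t: "t \<in> I" and x: "x \<in> chart_dom F i" and eq: "\<And>Z. g i (t, x) W Z = g i (t, x) W' Z"
  shows "W = W'"
proof -
  obtain a u a' u' where W: "W = (a, u)" "W' = (a', u')" by fastforce
  have "a = a'" using eq[of "(1, 0)"] x by (simp add: W)
  moreover have "gF i x (u - u') z = 0" for z
    using eq[of "(0, z)"] x f_pos[OF t] by (simp add: W)
  then have "u = u'" using metric_nondegenerate[OF x, of "u - u'"] by simp
  ultimately show ?thesis by (simp add: W)
qed

lemma pd_grw_metric:
  assumes t: "t \<in> I" and x: "x \<in> chart_dom F i"
  shows "pd M i (\<lambda>r. g i r (a, u) (b, v)) (t, x) (s, h)
    = 2 * f t * deriv f t * s * gF i x u v + (f t)\<^sup>2 * pd F i (\<lambda>r. gF i r u v) x h"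
proof -
  have "((\<lambda>s. (f s)\<^sup>2) has_real_derivative 2 * f t * deriv f t) (at t)"
    by (auto intro!: derivative_eq_intros f_deriv t)
  from has_derivative_add[OF has_derivative_const[of "- (a * b)"] has_derivative_mult_pullback[OF this metric_has_pd[OF x]]]
  have "((\<lambda>z. - (a * b) + (f (fst z))\<^sup>2 * gF i (chart_inv F i (snd z)) u v) has_derivative
     (\<lambda>k. 0 + ((f t)\<^sup>2 * pd F i (\<lambda>r. gF i r u v) x (snd k) + 2 * f t * deriv f t * fst k * gF i x u v)))
     (at (t, chart_map F i x))"
    by (simp only: chart_inv_map[OF x])
  from M_pd_eqI[OF this t x, of "\<lambda>r. g i r (a, u) (b, v)"] show ?thesis
    by simp
qed

text \<open>
  The candidate is the solution of the Koszul formula, read off from \<open>pd_grw_metric\<close>: the terms with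
  \<open>f f'\<close> that contain the time component of the test vector give the time component, and the
  others, divided by \<open>f^2\<close>, give the mixed terms with the factor \<open>f' / f\<close>.
\<close>

lemma christoffel_grw:
  assumes t: "t \<in> I" and x: "x \<in> chart_dom F i"
  shows "christoffel M g i (t, x) (a, u) (b, v)
    = (f t * deriv f t * gF i x u v,
       (deriv f t / f t) *\<^sub>R (a *\<^sub>R v + b *\<^sub>R u) + christoffel F gF i x u v)" (is "_ = ?W")
  unfolding christoffel_def[of M]
proof (rule the_equality)
  show *: "\<forall>Z. 2 * g i (t, x) ?W Z = pd M i (\<lambda>r. g i r (b, v) Z) (t, x) (a, u)
     + pd M i (\<lambda>r. g i r (a, u) Z) (t, x) (b, v) - pd M i (\<lambda>r. g i r (a, u) (b, v)) (t, x) Z"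
  proof
    fix Z :: "real \<times> 'e"
    obtain c z where Z: "Z = (c, z)" by fastforce
    have K: "(f t)\<^sup>2 * (2 * gF i x (christoffel F gF i x u v) z) = (f t)\<^sup>2 * (pd F i (\<lambda>r. gF i r v z) x u
       + pd F i (\<lambda>r. gF i r u z) x v - pd F i (\<lambda>r. gF i r u v) x z)"
      by (simp only: koszul_formula[OF x])
    have W: "g i (t, x) ?W Z = f t * deriv f t * (a * gF i x v z + b * gF i x u z - c * gF i x u v)
       + (f t)\<^sup>2 * gF i x (christoffel F gF i x u v) z"
      using f_pos[OF t] x by (simp add: Z field_simps power2_eq_square)
    show "2 * g i (t, x) ?W Z = pd M i (\<lambda>r. g i r (b, v) Z) (t, x) (a, u)
     + pd M i (\<lambda>r. g i r (a, u) Z) (t, x) (b, v) - pd M i (\<lambda>r. g i r (a, u) (b, v)) (t, x) Z"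
      unfolding W unfolding Z pd_grw_metric[OF t x] using K by (simp add: algebra_simps)
  qed
  show "W = ?W" if "\<forall>Z. 2 * g i (t, x) W Z = pd M i (\<lambda>r. g i r (b, v) Z) (t, x) (a, u)
     + pd M i (\<lambda>r. g i r (a, u) Z) (t, x) (b, v) - pd M i (\<lambda>r. g i r (a, u) (b, v)) (t, x) Z" for W
  proof (rule grw_metric_cancel[OF t x])
    fix Z
    have "2 * g i (t, x) W Z = 2 * g i (t, x) ?W Z"
      using that[rule_format, of Z] *[rule_format, of Z] by (rule trans[OF _ sym])
    then show "g i (t, x) W Z = g i (t, x) ?W Z" by linarith
  qed
qed

lemma pd_christoffel_grw:
  assumes t: "t \<in> I" and x: "x \<in> chart_dom F i"
  shows "pd M i (\<lambda>r. christoffel M g i r (a, u) (b, v)) (t, x) (s, h)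
    = (((deriv f t)\<^sup>2 + f t * deriv (deriv f) t) * s * gF i x u v
         + f t * deriv f t * pd F i (\<lambda>r. gF i r u v) x h,
       ((deriv (deriv f) t / f t - (deriv f t / f t)\<^sup>2) * s) *\<^sub>R (a *\<^sub>R v + b *\<^sub>R u)
         + pd F i (\<lambda>r. christoffel F gF i r u v) x h)"
proof -
  have 1: "((\<lambda>s. f s * deriv f s) has_real_derivative (deriv f t)\<^sup>2 + f t * deriv (deriv f) t) (at t)"
    by (rule derivative_eq_intros f_deriv t refl | simp add: power2_eq_square)+
  have 2: "((\<lambda>s. deriv f s / f s) has_real_derivative deriv (deriv f) t / f t - (deriv f t / f t)\<^sup>2) (at t)"
    using f_pos[OF t]
    by (auto intro!: derivative_eq_intros f_deriv t simp: power2_eq_square field_simps)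
  have 3: "((\<lambda>z. (f (fst z) * deriv f (fst z)) * gF i (chart_inv F i (snd z)) u v) has_derivative
    (\<lambda>k. (f t * deriv f t) * pd F i (\<lambda>r. gF i r u v) x (snd k)
       + (((deriv f t)\<^sup>2 + f t * deriv (deriv f) t) * fst k) * gF i x u v)) (at (t, chart_map F i x))"
    using has_derivative_mult_pullback[OF 1 metric_has_pd[OF x, of u v]] x by simp
  have 4: "((\<lambda>z. (deriv f (fst z) / f (fst z)) *\<^sub>R (a *\<^sub>R v + b *\<^sub>R u)
        + christoffel F gF i (chart_inv F i (snd z)) u v) has_derivative
    (\<lambda>k. ((deriv (deriv f) t / f t - (deriv f t / f t)\<^sup>2) * fst k) *\<^sub>R (a *\<^sub>R v + b *\<^sub>R u)
       + pd F i (\<lambda>r. christoffel F gF i r u v) x (snd k))) (at (t, chart_map F i x))"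
    by (intro has_derivative_add has_derivative_scaleR_left
        has_derivative_fst_pullback[where z = "(t, chart_map F i x)", simplified, OF 2]
        has_derivative_snd_pullback[where z = "(t, chart_map F i x)", simplified, OF christoffel_has_pd[OF x]])
  from M_pd_eqI[OF has_derivative_Pair[OF 3 4] t x, of "\<lambda>r. christoffel M g i r (a, u) (b, v)"]
  show ?thesis
    by (simp add: christoffel_grw add.commute)
qed

text \<open>
  Each of the \<open>n\<close> fiber directions contributes \<open>- (f'/f)' - (f'/f)^2 = - f''/f\<close>, and the time
  direction contributes nothing by the antisymmetry of the curvature.
\<close>

lemma ricci_grw_time:
  assumes t: "t \<in> I" and x: "x \<in> chart_dom F i"
  shows "ricci M g i (t, x) (1, 0) (1, 0) = - (real DIM('e) * deriv (deriv f) t / f t)"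
proof -
  have "curvature M g i (t, x) (0, b) (1, 0) (1, 0) \<bullet> (0, b) = - (deriv (deriv f) t / f t)"
    if "b \<in> Basis" for b
    using that x by (simp add: curvature_def pd_christoffel_grw[OF t x] christoffel_grw[OF t x] inner_diff_left
        power2_eq_square algebra_simps)
  moreover have "curvature M g i (t, x) (1, 0) (1, 0) (1, 0) = 0"
    by (simp add: curvature_def)
  ultimately show ?thesis
    by (simp add: ricci_def sum_Basis_prod)
qed

text \<open>
  The time direction contributes \<open>f f''\<close>. The fiber directions contribute the Ricci tensor of
  the fiber, and \<open>f'^2\<close> once for each of the \<open>n\<close> basis vectors \<open>b\<close>, minus the trace of the operator
  \<open>b \<mapsto> f'^2 g_F(b, w) v\<close>, which is one more \<open>f'^2 g_F(v, w)\<close>.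
\<close>

lemma ricci_grw_fiber:
  assumes t: "t \<in> I" and x: "x \<in> chart_dom F i"
  shows "ricci M g i (t, x) (0, v) (0, w) = ricci F gF i x v w
    + (f t * deriv (deriv f) t + (real DIM('e) - 1) * (deriv f t)\<^sup>2) * gF i x v w"
proof -
  let ?f' = "deriv f t" and ?f'' = "deriv (deriv f) t"
  have f: "f t \<noteq> 0" using f_pos[OF t] by simp
  have time: "curvature M g i (t, x) (1, 0) (0, v) (0, w) \<bullet> (1, 0) = f t * ?f'' * gF i x v w"
    using x f linear_0[OF linear_pd_metric[OF x]]
    by (simp add: curvature_def pd_christoffel_grw[OF t x] christoffel_grw[OF t x]
        power2_eq_square algebra_simps)
  have space: "curvature M g i (t, x) (0, b) (0, v) (0, w) \<bullet> (0, b)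
    = curvature F gF i x b v w \<bullet> b + (?f'\<^sup>2 * gF i x v w * (b \<bullet> b) - ?f'\<^sup>2 * gF i x ((v \<bullet> b) *\<^sub>R b) w)" for b
    using x f by (simp add: curvature_def pd_christoffel_grw[OF t x] christoffel_grw[OF t x]
        inner_diff_left inner_add_left power2_eq_square algebra_simps)
  have "linear (\<lambda>u. gF i x u w)" using bilinear_metric[OF x] by (simp add: bilinear_def)
  then have "(\<Sum>b\<in>Basis. gF i x ((v \<bullet> b) *\<^sub>R b) w) = gF i x v w"
    using linear_sum[of "\<lambda>u. gF i x u w" "\<lambda>b. (v \<bullet> b) *\<^sub>R b" Basis] by (simp add: euclidean_representation)
  then show ?thesis
    by (simp add: ricci_def sum_Basis_prod time space sum.distrib sum_subtractf
        sum_distrib_left[symmetric] algebra_simps del: bilinear_metric_simps)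
qed

lemma gradient_grw:
  assumes \<Phi>: "\<And>s. s \<in> I \<Longrightarrow> (\<Phi> has_real_derivative f s) (at s)" and t: "t \<in> I" and x: "x \<in> chart_dom F i"
  shows "gradient M g (\<lambda>(s, y). \<Phi> s) i (t, x) = (- f t, 0)"
  unfolding gradient_def
proof (rule the_equality)
  have "pd M i (\<lambda>(s, y). \<Phi> s) (t, x) = (\<lambda>k. f t * fst k)"
    by (rule M_pd_eqI[OF has_derivative_fst_pullback t x]) (use \<Phi> t in auto)
  then show *: "\<forall>Z. g i (t, x) (- f t, 0) Z = pd M i (\<lambda>(s, y). \<Phi> s) (t, x) Z"
    using x by auto
  show "W = (- f t, 0)" if "\<forall>Z. g i (t, x) W Z = pd M i (\<lambda>(s, y). \<Phi> s) (t, x) Z" for W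
    by (rule grw_metric_cancel[OF t x]) (simp only: that[rule_format] *[rule_format])
qed

text \<open>
  Along \<open>- f \<partial>_t\<close> the fiber part \<open>f^2 g_F\<close> changes at the rate \<open>- 2 f^2 f' g_F\<close>, and the
  dependence of the field on \<open>t\<close> changes the time part \<open>- dt^2\<close> by \<open>2 f' dt^2\<close>: both are \<open>- 2 f'\<close> times
  the corresponding part of \<open>g\<close>.
\<close>

lemma lie_derivative_gradient_grw:
  assumes \<Phi>: "\<And>s. s \<in> I \<Longrightarrow> (\<Phi> has_real_derivative f s) (at s)" and t: "t \<in> I" and x: "x \<in> chart_dom F i"
  shows "lie_derivative M (gradient M g (\<lambda>(s, y). \<Phi> s)) g i (t, x) V W = - 2 * deriv f t * g i (t, x) V W"
proof -
  obtain a u b v where VW: "V = (a, u)" "W = (b, v)" by fastforce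
  have "((\<lambda>z. (- f (fst z), 0)) has_derivative (\<lambda>k. (- (deriv f t * fst k), 0))) (at (t, chart_map F i x))"
    by (intro has_derivative_Pair has_derivative_minus has_derivative_fst_pullback has_derivative_const)
       (simp add: f_deriv t)
  from M_pd_eqI[OF this t x, of "gradient M g (\<lambda>(s, y). \<Phi> s) i"]
  have "pd M i (gradient M g (\<lambda>(s, y). \<Phi> s) i) (t, x) = (\<lambda>k. (- (deriv f t * fst k), 0))"
    by (simp add: gradient_grw[OF \<Phi>])
  then show ?thesis
    using x linear_0[OF linear_pd_metric[OF x]]
    by (simp add: lie_derivative_def gradient_grw[OF \<Phi> t x] VW pd_grw_metric[OF t x] power2_eq_square algebra_simps)
qed

end

section \<open>The warping equations and the theorem\<close>

text \<open>
  The first equation integrates to \<open>n f' = f^2 + c\<close>. Inserting this into the second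
  leaves \<open>(n - 1) (f^2 + c) (f^2 - c) / n^2 = k\<close>, so that \<open>f^4\<close> is constant; for this
  \<open>n > 1\<close> is essential, since for \<open>n = 1\<close> the second equation follows from the first with
  \<open>k = 0\<close> and \<open>f = tan\<close> solves both on \<open>(0, pi/2)\<close>.
\<close>

lemma static_warping:
  fixes f :: "real \<Rightarrow> real" and n k :: real
  assumes I: "open I" "is_interval I" and n: "n > 1"
    and f: "\<And>t. t \<in> I \<Longrightarrow> (f has_real_derivative f' t) (at t)"
    and f': "\<And>t. t \<in> I \<Longrightarrow> (f' has_real_derivative f'' t) (at t)"
    and pos: "\<And>t. t \<in> I \<Longrightarrow> 0 < f t"
    and time: "\<And>t. t \<in> I \<Longrightarrow> n * f'' t = 2 * f t * f' t"
    and space: "\<And>t. t \<in> I \<Longrightarrow> 2 * f' t * (f t)\<^sup>2 - f t * f'' t - (n - 1) * (f' t)\<^sup>2 = k"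
    and t: "t \<in> I"
  shows "f' t = 0"
proof -
  have "\<exists>c. \<forall>s\<in>I. n * f' s - (f s)\<^sup>2 = c"
  proof (rule has_field_derivative_zero_constant)
    show "convex I" using I(2) by (simp add: is_interval_convex)
    fix s assume s: "s \<in> I"
    have "((\<lambda>s. n * f' s - (f s)\<^sup>2) has_real_derivative n * f'' s - 2 * f s * f' s) (at s)"
      by (auto intro!: derivative_eq_intros f f' s)
    then show "((\<lambda>s. n * f' s - (f s)\<^sup>2) has_real_derivative 0) (at s within I)"
      using time[OF s] by (auto intro: has_field_derivative_at_within)
  qed
  then obtain c where const: "\<forall>s\<in>I. n * f' s - (f s)\<^sup>2 = c" by blast
  have c: "n * f' s = (f s)\<^sup>2 + c" if "s \<in> I" for s
    using bspec[OF const that] by linarith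
  have "(f s)^4 = n\<^sup>2 * k / (n - 1) + c\<^sup>2" if s: "s \<in> I" for s
  proof -
    \<comment> \<open>The factor \<open>n^2\<close> lets \<open>n f'\<close> and \<open>n f''\<close> occur, which are known in terms of \<open>f\<close> and \<open>n f'\<close>.\<close>
    have "n\<^sup>2 * k = 2 * n * (n * f' s) * (f s)\<^sup>2 - n * f s * (n * f'' s) - (n - 1) * (n * f' s)\<^sup>2"
      unfolding space[OF s, symmetric] by (simp add: power2_eq_square algebra_simps)
    also have "\<dots> = 2 * n * (n * f' s) * (f s)\<^sup>2 - 2 * (f s)\<^sup>2 * (n * f' s) - (n - 1) * (n * f' s)\<^sup>2"
      unfolding time[OF s] by (simp add: power2_eq_square)
    also have "\<dots> = (n - 1) * ((f s)^4 - c\<^sup>2)"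
      unfolding c[OF s] by (simp add: power2_eq_square power4_eq_xxxx algebra_simps)
    finally show ?thesis using n by (simp add: field_simps)
  qed
  then have "((\<lambda>s. (f s)^4) has_real_derivative 0) (at t)"
    by (intro has_field_derivative_transform_within_open[OF DERIV_const[of "n\<^sup>2 * k / (n - 1) + c\<^sup>2"] I(1) t]) simp
  moreover have "((\<lambda>s. (f s)^4) has_real_derivative 4 * (f t)^3 * f' t) (at t)"
    by (auto intro!: derivative_eq_intros f t)
  ultimately have "4 * (f t)^3 * f' t = 0" by (rule DERIV_unique[rotated])
  then show ?thesis using pos[OF t] by simp
qed

theorem theorem5p1:
  fixes F :: "('a, 'e::euclidean_space, 'i) manifold"
    and gF :: "('a, 'e, 'i) tensor02"
    and I :: "real set"
    and f :: "real \<Rightarrow> real"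
    and p :: "real \<times> 'a \<Rightarrow> real"
    and c lam :: real
    and n :: nat
  defines "n \<equiv> DIM('e)"
  defines "M \<equiv> grw_manifold I F"
    and "g \<equiv> grw_metric f gF"
  defines "\<mu> \<equiv> (\<lambda>q. 2 * lam - (p q + 2 / real n))"
    and "\<phi> \<equiv> (\<lambda>(t::real, x::'a). LBINT z=ereal c..ereal t. f z)"
  assumes "smooth_manifold F" and "riemannian_metric F gF"
    and "open I" and "is_interval I" and "c \<in> I"
    and "smooth_on I f" and "\<And>t. t \<in> I \<Longrightarrow> 0 < f t"
    and "smooth_scalar_field M p"
    and "conformal_gradient_ricci_soliton M g \<mu> \<phi>"
  shows "(2 \<le> n \<longrightarrow>
            (\<forall>t x. (t, x) \<in> topspace (mtop M) \<longrightarrow> lam = deriv f t + p (t, x) / 2 + 1 / real n) \<longrightarrow>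
            ricci_flat M g)
       \<and> ((\<exists>a b. \<forall>t\<in>I. f t = a * t + b) \<longrightarrow> einstein M g)"
proof -
  let ?f' = "deriv f" and ?f'' = "deriv (deriv f)"
  note pos = \<open>\<And>t. t \<in> I \<Longrightarrow> 0 < f t\<close>
  note f_deriv = smooth_on_real_derivs[OF \<open>smooth_on I f\<close> \<open>open I\<close>]
  have chart: "grw_chart F gF i I f" if "i \<in> atlas F" for i
    using assms that by unfold_locales auto
  have M [simp]: "atlas M = atlas F" "chart_dom M i = I \<times> chart_dom F i" for i
    by (simp_all add: M_def grw_manifold_def)
  have "continuous_on I f"
    using f_deriv(1) by (meson DERIV_isCont continuous_at_imp_continuous_on)
  then have \<Phi>: "((\<lambda>s. LBINT z=ereal c..ereal s. f z) has_real_derivative f t) (at t)" if "t \<in> I" for t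
    using interval_integral_has_derivative that assms by blast
  have ricci: "ricci M g i (t, x) V W = (\<mu> (t, x) / 2 + ?f' t) * g i (t, x) V W"
    if "i \<in> atlas F" "t \<in> I" "x \<in> chart_dom F i" for i t x V W
  proof -
    have "lie_derivative M (gradient M g \<phi>) g i (t, x) V W + 2 * ricci M g i (t, x) V W
        = \<mu> (t, x) * g i (t, x) V W"
      using \<open>conformal_gradient_ricci_soliton M g \<mu> \<phi>\<close> that
      by (cases V; cases W) (simp add: conformal_gradient_ricci_soliton_def)
    then show ?thesis
      using grw_chart.lie_derivative_gradient_grw[OF chart[OF that(1)] \<Phi> that(2,3), of V W]
      by (simp add: M_def g_def \<phi>_def algebra_simps)
  qed
  \<comment> \<open>Evaluation at the timelike unit field, where \<open>g\<close> has the value \<open>-1\<close>, determines the factor.\<close>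
  have time: "\<mu> (t, x) / 2 + ?f' t = real n * ?f'' t / f t"
    if i: "i \<in> atlas F" and t: "t \<in> I" and x: "x \<in> chart_dom F i" for i t x
  proof -
    interpret grw_chart F gF i I f by (rule chart[OF i])
    show ?thesis
      using ricci[OF i t x, of "(1, 0)" "(1, 0)"] ricci_grw_time[OF t x] x
      by (simp add: M_def g_def n_def)
  qed
  have "ricci_flat M g"
    if n: "2 \<le> n"
      and lam: "\<forall>t x. (t, x) \<in> topspace (mtop M) \<longrightarrow> lam = deriv f t + p (t, x) / 2 + 1 / real n"
  proof -
    have "ricci M g i (t, x) V W = 0"
      if i: "i \<in> atlas F" and t: "t \<in> I" and x: "x \<in> chart_dom F i" for i t x V W
    proof -
      interpret grw_chart F gF i I f by (rule chart[OF i])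
      have "x \<in> topspace (mtop F)"
        using \<open>smooth_manifold F\<close> i x by (auto simp: smooth_manifold_def)
      then have mu: "\<mu> (s, x) / 2 + ?f' s = 2 * ?f' s" if "s \<in> I" for s
        using lam[rule_format, of s x] that by (simp add: M_def grw_manifold_def \<mu>_def field_simps)
      obtain b :: 'e where "b \<in> Basis" using nonempty_Basis by blast
      then have b: "0 < gF i x b b" using metric_pos[OF x, of b] by (simp add: nonzero_Basis)
      have "?f' t = 0"
      proof (rule static_warping[OF \<open>open I\<close> \<open>is_interval I\<close> _ f_deriv pos _ _ t])
        show "real n > 1" using n by simp
        show "real n * ?f'' s = 2 * f s * ?f' s" if "s \<in> I" for s
          using time[OF i that x] mu[OF that] pos[OF that] by (simp add: field_simps)
        show "2 * ?f' s * (f s)\<^sup>2 - f s * ?f'' s - (real n - 1) * (?f' s)\<^sup>2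
            = ricci F gF i x b b / gF i x b b" if "s \<in> I" for s
          using ricci[OF i that x, of "(0, b)" "(0, b)"] ricci_grw_fiber[OF that x, of b b] mu[OF that] b
          by (simp add: M_def g_def n_def field_simps)
      qed
      then show ?thesis using ricci[OF i t x] mu[OF t] by simp
    qed
    then show ?thesis by (auto simp: ricci_flat_def)
  qed
  moreover have "einstein M g" if affine: "\<exists>a b. \<forall>t\<in>I. f t = a * t + b"
  proof -
    obtain a b where ab: "\<And>s. s \<in> I \<Longrightarrow> f s = a * s + b" using affine by blast
    have f': "?f' s = a" if "s \<in> I" for s
    proof -
      have "((\<lambda>s. a * s + b) has_real_derivative a) (at s)"
        by (auto intro!: derivative_eq_intros)
      then have "(f has_real_derivative a) (at s)"
        by (rule has_field_derivative_transform_within_open[OF _ \<open>open I\<close> that]) (simp add: ab)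
      then show ?thesis by (rule DERIV_imp_deriv)
    qed
    have "(?f' has_real_derivative 0) (at s)" if "s \<in> I" for s
      by (rule has_field_derivative_transform_within_open[OF DERIV_const[of a] \<open>open I\<close> that]) (simp add: f')
    then have "?f'' s = 0" if "s \<in> I" for s
      using that by (blast intro: DERIV_imp_deriv)
    then have "ricci M g i (t, x) V W = 0 * g i (t, x) V W"
      if "i \<in> atlas F" "t \<in> I" "x \<in> chart_dom F i" for i t x V W
      using ricci[OF that] time[OF that] that by simp
    then show ?thesis by (auto simp: einstein_def)
  qed
  ultimately show ?thesis by blast
qed

end
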